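(* There is an absolute constant $C>0$ such that the following holds. Let $z_{-1}\in\mathbb{C}\cong\mathbb{R}^2$ and let $(z_n)_{n\ge -1}$ be the greedy sequence associated with the base $2$ van der Corput sequence started at $z_{-1}$. Then there is an integer $0 \le N \le C|z_{-1}|$ such that either the sequence has become indeterminate within its first $N$ steps, or after at most $N$ steps the sequence has reached $B(0,\sqrt2)$, i.e. $z_{m}\in B(0,\sqrt 2)$ for some $-1\le m\le N-1$.
   Context: For $n=\sum_{k=0}^{\ell} a_k 2^k$ with $a_k\in\{0,1\}$, the base $2$ van der Corput sequence is $\mathrm{Vdc}_2(n)=\sum_{k=0}^{\ell} a_k 2^{-k-1}$ (so $\mathrm{Vdc}_2(0)=0$). Given $z_{-1}\in\mathbb{C}$, define for $n\ge 0$, with $v_n=e^{2\pi i\,\mathrm{Vdc}_2(n)}$: $z_n=z_{n-1}+v_n$ if $|z_{n-1}+v_n|<|z_{n-1}-v_n|$, and $z_n=z_{n-1}-v_n$ if $|z_{n-1}-v_n|<|z_{n-1}+v_n|$. If the two norms are equal, the sequence is called indeterminate and stops: $z_n$ and all later terms are undefined. Going from $z_{n-1}$ to $z_n$ is one step. $B(0,r)$ denotes the open disk of radius $r$ centered at the origin. *)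

theory Defs
  imports "HOL-Analysis.Analysis"
begin

text \<open>All binary digits of \<open>n\<close> at positions \<open>k > n\<close> vanish, so summing up to \<open>n\<close> covers the
  whole expansion; see \<open>vdc2_binary_expansion\<close> below.\<close>

definition vdc2 :: "nat \<Rightarrow> real" where
  "vdc2 n = (\<Sum>k\<le>n. of_bool (bit n k) / 2 ^ (k + 1))"

definition vdc2_unit :: "nat \<Rightarrow> complex" where
  "vdc2_unit n = exp (2 * of_real pi * \<i> * of_real (vdc2 n))"

text \<open>The index is shifted by one: \<open>greedy v z n\<close> is the term \<open>z\<^bsub>n-1\<^esub>\<close> of the greedy sequence
  with \<open>z\<^bsub>-1\<^esub> = z\<close>, that is, its value after \<open>n\<close> steps. It is \<open>None\<close> when the sequence has
  become indeterminate during the first \<open>n\<close> steps.\<close>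

primrec greedy :: "(nat \<Rightarrow> complex) \<Rightarrow> complex \<Rightarrow> nat \<Rightarrow> complex option" where
  "greedy v z 0 = Some z"
| "greedy v z (Suc n) =
     (case greedy v z n of
        None \<Rightarrow> None
      | Some w \<Rightarrow>
          if norm (w + v n) < norm (w - v n) then Some (w + v n)
          else if norm (w - v n) < norm (w + v n) then Some (w - v n)
          else None)"

lemma bit_binary_sum:
  fixes a :: "nat \<Rightarrow> nat"
  assumes "\<And>k. a k \<in> {0, 1}"
  shows "bit (\<Sum>k<l. a k * 2 ^ k) j \<longleftrightarrow> j < l \<and> a j = 1"
  using assms
proof (induction l arbitrary: a j)
  case 0
  then show ?case by simp
next
  case (Suc l)
  let ?S = "\<Sum>k<l. a (Suc k) * 2 ^ k"
  have eq: "(\<Sum>k<Suc l. a k * 2 ^ k) = a 0 + 2 * ?S"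
    by (subst sum.lessThan_Suc_shift) (simp add: sum_distrib_left mult_ac)
  have a0: "a 0 = 0 \<or> a 0 = 1" using Suc.prems[of 0] by auto
  show ?case
  proof (cases j)
    case 0
    then show ?thesis unfolding eq using a0 by (auto simp: bit_0)
  next
    case (Suc i)
    have "(a 0 + 2 * ?S) div 2 = ?S" using a0 by auto
    then show ?thesis
      unfolding eq Suc using Suc.IH[of "\<lambda>k. a (Suc k)" i] Suc.prems by (simp add: bit_Suc)
  qed
qed

lemma vdc2_binary_expansion:
  fixes a :: "nat \<Rightarrow> nat"
  assumes a: "\<And>k. k \<le> l \<Longrightarrow> a k \<in> {0, 1}"
    and n: "n = (\<Sum>k\<le>l. a k * 2 ^ k)"
  shows "vdc2 n = (\<Sum>k\<le>l. real (a k) / 2 ^ (k + 1))"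
proof -
  define b where "b k = (if k \<le> l then a k else 0)" for k
  have b: "b k \<in> {0, 1}" for k using a[of k] by (auto simp: b_def)
  have "n = (\<Sum>k<Suc l. b k * 2 ^ k)"
    unfolding n lessThan_Suc_atMost by (intro sum.cong) (auto simp: b_def)
  then have bit: "bit n k \<longleftrightarrow> k \<le> l \<and> a k = 1" for k
    using bit_binary_sum[of b "Suc l" k, OF b] by (auto simp: b_def)
  have le: "k \<le> n" if "bit n k" for k
  proof (rule ccontr)
    assume "\<not> k \<le> n"
    then have "n < 2 ^ k" by (meson less_exp less_trans not_le)
    then show False using that by (simp add: bit_iff_odd)
  qed
  have "vdc2 n = (\<Sum>k | bit n k. 1 / 2 ^ (k + 1))"
    unfolding vdc2_def by (rule sum.mono_neutral_cong_right) (auto dest: le)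
  also have "\<dots> = (\<Sum>k\<le>l. real (a k) / 2 ^ (k + 1))"
  proof (rule sum.mono_neutral_cong_left)
    show "\<forall>i\<in>{..l} - {k. bit n k}. real (a i) / 2 ^ (i + 1) = 0"
    proof
      fix i assume "i \<in> {..l} - {k. bit n k}"
      then show "real (a i) / 2 ^ (i + 1) = 0" using a[of i] by (auto simp: bit)
    qed
  qed (auto simp: bit)
  finally show ?thesis .
qed

end

theory Submission
  imports Defs
begin

text \<open>The directions \<open>v\<^bsub>4k\<^esub>, \<dots>, v\<^bsub>4k+3\<^esub>\<close> are \<open>u, -u, \<i>u, -\<i>u\<close>, so in the orthonormal frame
  \<open>(u, \<i>u)\<close> four greedy steps act on the two coordinates separately: a coordinate \<open>x\<close> with
  \<open>\<bar>x\<bar> < 1\<close> is kept, and one with \<open>\<bar>x\<bar> > 1\<close> is moved by \<open>2\<close> towards the origin, which lowers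
  \<open>x\<^sup>2\<close> by \<open>4(\<bar>x\<bar> - 1)\<close>. Outside \<open>B(0, \<surd>2)\<close> this gain is small only if both coordinates are
  close to \<open>1\<close> in modulus. The frame of the next four steps (for even \<open>k\<close>) is rotated by 45
  degrees, so such a point then has a coordinate close to \<open>\<surd>2\<close> and the gain is large. Hence
  eight steps lower the norm by at least a fixed constant.\<close>

lemma vdc2_eq_sum:
  assumes "n \<le> l"
  shows "vdc2 n = (\<Sum>k\<le>l. of_bool (bit n k) / 2 ^ (k + 1))"
  unfolding vdc2_def
proof (rule sum.mono_neutral_left)
  show "\<forall>i\<in>{..l} - {..n}. of_bool (bit n i) / 2 ^ (i + 1) = (0::real)"
  proof
    fix i assume "i \<in> {..l} - {..n}"
    then have "n < 2 ^ i" by (auto intro: less_trans[OF _ less_exp])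
    then show "of_bool (bit n i) / 2 ^ (i + 1) = (0::real)" by (simp add: bit_iff_odd)
  qed
qed (use assms in auto)

text \<open>A new lowest binary digit of the index becomes the first digit after the binary point,
  and all other digits move one place further right.\<close>

lemma vdc2_double: "vdc2 (2 * n) = vdc2 n / 2"
  and vdc2_double_Suc: "vdc2 (Suc (2 * n)) = vdc2 n / 2 + 1 / 2"
proof -
  have *: "vdc2 m = of_bool (odd m) / 2 + vdc2 (m div 2) / 2" if "m \<le> Suc (2 * n)" for m
    using that
    by (subst vdc2_eq_sum[of m "Suc (2 * n)"], simp, subst vdc2_eq_sum[of "m div 2" "2 * n"], simp,
        subst sum.atMost_Suc_shift) (simp add: bit_0 bit_Suc sum_divide_distrib mult.commute)
  show "vdc2 (2 * n) = vdc2 n / 2" "vdc2 (Suc (2 * n)) = vdc2 n / 2 + 1 / 2"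
    using *[of "2 * n"] *[of "Suc (2 * n)"] by simp_all
qed

lemma norm_vdc2_unit [simp]: "norm (vdc2_unit n) = 1"
  by (simp add: vdc2_unit_def norm_exp_eq_Re)

lemma vdc2_unit_nonzero [simp]: "vdc2_unit n \<noteq> 0"
  by (simp add: vdc2_unit_def)

lemma vdc2_unit_shift:
  "vdc2 m = vdc2 n + t \<Longrightarrow> vdc2_unit m = cis (2 * pi * t) * vdc2_unit n"
  by (simp add: vdc2_unit_def cis_conv_exp exp_add[symmetric] algebra_simps)

text \<open>Setting bit 0, 1 or 2 of an index adds 1/2, 1/4 or 1/8 to \<open>vdc2\<close>, hence
  turns the direction by 180, 90 or 45 degrees. This and the next two lemmas record these
  turns.\<close>

lemma vdc2_unit_Suc_double: "vdc2_unit (Suc (2 * n)) = - vdc2_unit (2 * n)"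
  using vdc2_unit_shift[of "Suc (2 * n)" "2 * n" "1/2"]
  by (simp add: vdc2_double vdc2_double_Suc)

lemma vdc2_unit_4: "vdc2_unit (4 * n + 2) = \<i> * vdc2_unit (4 * n)"
proof -
  have "vdc2 (4 * n + 2) = vdc2 (4 * n) + 1 / 4"
    using vdc2_double[of "Suc (2 * n)"] vdc2_double_Suc[of n] vdc2_double[of "2 * n"]
      vdc2_double[of n] by simp
  from vdc2_unit_shift[OF this] show ?thesis by simp
qed

lemma vdc2_unit_8: "vdc2_unit (4 * Suc (2 * n)) = cis (pi / 4) * vdc2_unit (4 * (2 * n))"
proof -
  have 4: "4 * m = 2 * (2 * m)" for m :: nat by simp
  have "vdc2 (4 * Suc (2 * n)) = vdc2 (4 * (2 * n)) + 1 / 8"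
    by (simp only: 4 vdc2_double vdc2_double_Suc) simp
  from vdc2_unit_shift[OF this] show ?thesis by simp
qed

lemma greedy_Some_le:
  assumes "greedy v z n = Some w" "m \<le> n"
  shows "\<exists>x. greedy v z m = Some x"
proof -
  have "greedy v z n = None" if "greedy v z m = None"
    using assms(2) that by (induction rule: dec_induct) simp_all
  then show ?thesis using assms(1) by (cases "greedy v z m") auto
qed

text \<open>The greedy rule is symmetric under changing the sign of the direction, so
  \<open>u\<close> and \<open>- u\<close> can share one frame. There the comparison only sees
  \<open>Re p\<close>, since |p + 1|^2 - |p - 1|^2 = 4 Re p.\<close>

lemma greedy_Suc_in_frame:
  assumes "v n = u \<or> v n = - u" "norm u = 1" "greedy v z n = Some (p * u)"
    and "greedy v z (Suc n) = Some w"
  shows "Re p \<noteq> 0" "w = (p - of_real (sgn (Re p))) * u"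
proof -
  have eq: "p * t + t = (p + 1) * t" "p * t - t = (p - 1) * t" for t
    by (simp_all add: algebra_simps)
  have less: "cmod (p + 1) < cmod (p - 1) \<longleftrightarrow> Re p < 0" "cmod (p - 1) < cmod (p + 1) \<longleftrightarrow> Re p > 0"
    by (simp_all add: cmod_def power2_eq_square algebra_simps)
  show "Re p \<noteq> 0" "w = (p - of_real (sgn (Re p))) * u"
    using assms less by (auto simp: eq norm_mult sgn_if split: if_splits)
qed

text \<open>The net effect of steps along \<open>u\<close> and \<open>- u\<close> on the coordinate
  along \<open>u\<close>. For x = 0 and |x| = 1 these steps are indeterminate; the values there are
  a convention under which \<open>pull_power2\<close> holds for every real number.\<close>

definition pull :: "real \<Rightarrow> real" where
  "pull x = (if \<bar>x\<bar> \<le> 1 then x else x - 2 * sgn x)"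

text \<open>The first step replaces the coordinate x by x - sgn x. This reverses its sign if |x| <
  1, and then the second step undoes the first; if |x| > 1, the sign is kept and the second step
  repeats the first.\<close>

lemma greedy_two_steps:
  assumes "v n = u" "v (Suc n) = - u" "norm u = 1"
    and w: "greedy v z n = Some (p * u)" "greedy v z (Suc (Suc n)) = Some w"
  shows "w = Complex (pull (Re p)) (Im p) * u"
proof -
  obtain w1 where w1: "greedy v z (Suc n) = Some w1"
    using greedy_Some_le[OF w(2), of "Suc n"] by (auto simp del: greedy.simps)
  note 1 = greedy_Suc_in_frame[of v n u z p w1, OF _ assms(3) w(1) w1]
  have "Re p \<noteq> 0" and w1_eq: "w1 = (p - of_real (sgn (Re p))) * u" using 1 assms by auto
  note 2 = greedy_Suc_in_frame[of v "Suc n" u z _ w, OF _ assms(3) w1[unfolded w1_eq] w(2)]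
  show ?thesis
    using 2 assms(1,2) \<open>Re p \<noteq> 0\<close>
    by (auto simp: pull_def complex_eq_iff sgn_if abs_if split: if_splits)
qed

lemma greedy_vdc2_four_steps:
  assumes "greedy vdc2_unit z (4 * n) = Some (p * vdc2_unit (4 * n))"
    and "greedy vdc2_unit z (4 * n + 4) = Some w"
  shows "w = Complex (pull (Re p)) (pull (Im p)) * vdc2_unit (4 * n)"
proof -
  let ?u = "vdc2_unit (4 * n)" and ?g = "greedy vdc2_unit z"
  have idx: "Suc (Suc (4 * n)) = 4 * n + 2" "Suc (Suc (4 * n + 2)) = 4 * n + 4" by simp_all
  obtain w2 where w2: "?g (4 * n + 2) = Some w2"
    using greedy_Some_le[OF assms(2), of "4 * n + 2"] by (auto simp del: greedy.simps)
  have "vdc2_unit (Suc (4 * n)) = - ?u"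
    using vdc2_unit_Suc_double[of "2 * n"] by simp
  from greedy_two_steps[OF refl this _ assms(1), unfolded idx, OF _ w2]
  have "w2 = Complex (pull (Re p)) (Im p) * ?u" by simp
  \<comment> \<open>In the frame of \<open>\<i> * ?u\<close> the untouched coordinate
    \<open>Im p\<close> becomes the real part, ready for the next pair of steps.\<close>
  also have "\<dots> = Complex (Im p) (- pull (Re p)) * (\<i> * ?u)"
    by (simp add: complex_eq_iff)
  finally have w2': "?g (4 * n + 2) = Some (Complex (Im p) (- pull (Re p)) * (\<i> * ?u))"
    using w2 by simp
  have "vdc2_unit (Suc (4 * n + 2)) = - (\<i> * ?u)"
    using vdc2_unit_Suc_double[of "2 * n + 1"] vdc2_unit_4[of n] by simp
  from greedy_two_steps[OF vdc2_unit_4 this _ w2', unfolded idx, OF _ assms(2)]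
  have "w = Complex (pull (Im p)) (- pull (Re p)) * (\<i> * ?u)" by (simp add: norm_mult)
  also have "\<dots> = Complex (pull (Re p)) (pull (Im p)) * ?u"
    by (simp add: complex_eq_iff)
  finally show ?thesis .
qed

lemma pull_power2: "(pull x)\<^sup>2 = x\<^sup>2 - max 0 (4 * (\<bar>x\<bar> - 1))"
  by (auto simp: pull_def sgn_if power2_eq_square algebra_simps)

lemma pull_power2_le: "(pull x)\<^sup>2 \<le> x\<^sup>2" "(pull x)\<^sup>2 \<le> x\<^sup>2 - 4 * (\<bar>x\<bar> - 1)"
  by (simp_all add: pull_power2)

text \<open>The arguments of the outer \<open>pull\<close> are the coordinates of (a, b) in the
  frame rotated by 45 degrees. The loss is proportional to the norm r because r^2 - r/4 \<le> (r -
  1/8)^2 turns it into a constant loss of norm.\<close>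

lemma two_frames_decrease:
  fixes x y :: real
  defines "a \<equiv> pull x" and "b \<equiv> pull y"
  assumes "2 \<le> x\<^sup>2 + y\<^sup>2"
  shows "(pull ((a + b) / sqrt 2))\<^sup>2 + (pull ((b - a) / sqrt 2))\<^sup>2
    \<le> x\<^sup>2 + y\<^sup>2 - sqrt (x\<^sup>2 + y\<^sup>2) / 4"
proof -
  let ?c = "(a + b) / sqrt 2" and ?d = "(b - a) / sqrt 2"
  define M where "M = max \<bar>x\<bar> \<bar>y\<bar>"
  have ab: "a\<^sup>2 + b\<^sup>2 = ?c\<^sup>2 + ?d\<^sup>2"
    by (simp add: power_divide) (simp add: field_simps power2_eq_square)
  have sq: "x\<^sup>2 \<le> M\<^sup>2" "y\<^sup>2 \<le> M\<^sup>2" "M \<ge> 0"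
    unfolding M_def by (auto simp: abs_le_square_iff[symmetric])
  have s: "sqrt (x\<^sup>2 + y\<^sup>2) \<le> 3/2 * M"
  proof (rule real_le_lsqrt)
    have "x\<^sup>2 + y\<^sup>2 \<le> 9/4 * M\<^sup>2" using sq zero_le_power2[of M] by linarith
    then show "x\<^sup>2 + y\<^sup>2 \<le> (3/2 * M)\<^sup>2" by (simp add: power_mult_distrib power_divide)
  qed (use sq in auto)
  show ?thesis
  \<comment> \<open>The threshold is large enough for 4(M - 1) \<ge> 3M/8, so that the first frame
    suffices above it. It is small enough for 2 - 1.12^2 \<ge> 0.86^2, so that below it both
    coordinates are at least 0.86 in modulus.\<close>
  proof (cases "M \<ge> 112/100")
    case True
    define D where "D = max 0 (4 * (\<bar>x\<bar> - 1)) + max 0 (4 * (\<bar>y\<bar> - 1))"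
    have "4 * (M - 1) \<le> D"
      unfolding M_def D_def by linarith
    moreover have "(pull ?c)\<^sup>2 + (pull ?d)\<^sup>2 \<le> a\<^sup>2 + b\<^sup>2"
      unfolding ab by (intro add_mono pull_power2_le)
    moreover have "a\<^sup>2 + b\<^sup>2 = x\<^sup>2 + y\<^sup>2 - D"
      unfolding D_def a_def b_def pull_power2 by linarith
    moreover have "sqrt (x\<^sup>2 + y\<^sup>2) / 4 \<le> D" using calculation(1) s True by argo
    ultimately show ?thesis by linarith
  next
    case False
    then have "M\<^sup>2 \<le> (112/100)\<^sup>2" using sq by (intro power_mono) auto
    then have "(86/100)\<^sup>2 \<le> x\<^sup>2" "(86/100)\<^sup>2 \<le> y\<^sup>2"
      using sq assms(3) by (auto simp: power2_eq_square)
    then have "86/100 \<le> \<bar>x\<bar>" "86/100 \<le> \<bar>y\<bar>"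
      by (auto simp flip: abs_le_square_iff)
    \<comment> \<open>A coordinate with 1 < |x| < 1.12 is sent to one of modulus 2 - |x| > 0.88; the
      others stay.\<close>
    then have "86/100 \<le> \<bar>a\<bar>" "86/100 \<le> \<bar>b\<bar>"
      using False unfolding a_def b_def M_def pull_def by (auto simp: sgn_if abs_if split: if_splits)
    \<comment> \<open>The maximum equals |a| + |b|. The bound 43/30 for \<open>sqrt 2\<close> is
      1.72 divided by 6/5, and a coordinate of modulus at least 6/5 loses 4/5, more than the
      required 3M/8 < 0.42.\<close>
    then have "172/100 \<le> max \<bar>a + b\<bar> \<bar>b - a\<bar>" by linarith
    moreover have "sqrt 2 \<le> 43/30"
      by (rule real_le_lsqrt) (simp_all add: power2_eq_square)
    ultimately have "6/5 * sqrt 2 \<le> max \<bar>a + b\<bar> \<bar>b - a\<bar>" by linarith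
    then have "6/5 \<le> \<bar>?c\<bar> \<or> 6/5 \<le> \<bar>?d\<bar>"
      by (auto simp: le_max_iff_disj pos_le_divide_eq)
    then have "(pull ?c)\<^sup>2 + (pull ?d)\<^sup>2 \<le> a\<^sup>2 + b\<^sup>2 - 4/5"
      unfolding ab using pull_power2_le[of ?c] pull_power2_le[of ?d] by argo
    moreover have "a\<^sup>2 + b\<^sup>2 \<le> x\<^sup>2 + y\<^sup>2"
      unfolding a_def b_def by (intro add_mono pull_power2_le)
    ultimately show ?thesis using s False by linarith
  qed
qed

lemma greedy_vdc2_eight_steps:
  assumes w: "greedy vdc2_unit z (8 * n) = Some w"
    and w': "greedy vdc2_unit z (8 * n + 8) = Some w'"
    and "sqrt 2 \<le> norm w"
  shows "norm w' \<le> norm w - 1 / 8"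
proof -
  let ?u = "vdc2_unit (4 * (2 * n))" and ?u' = "vdc2_unit (4 * Suc (2 * n))"
    and ?g = "greedy vdc2_unit z"
  define p where "p = w / ?u"
  define a b where "a = pull (Re p)" and "b = pull (Im p)"
  have p: "?g (4 * (2 * n)) = Some (p * ?u)" "norm p = norm w"
    using w by (simp_all add: p_def norm_divide)
  obtain w1 where w1: "?g (4 * (2 * n) + 4) = Some w1"
    using greedy_Some_le[OF w', of "4 * (2 * n) + 4"] by (auto simp del: greedy.simps)
  have "w1 = Complex a b * ?u"
    unfolding a_def b_def by (rule greedy_vdc2_four_steps[OF p(1) w1])
  \<comment> \<open>The factor \<open>cis (pi / 4)\<close> is split off to be absorbed into
    \<open>?u'\<close>, the first direction of the next four steps.\<close>
  also have "Complex a b = Complex ((a + b) / sqrt 2) ((b - a) / sqrt 2) * cis (pi / 4)"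
    by (simp add: complex_eq_iff cos_45 sin_45 field_simps)
  finally have "?g (4 * Suc (2 * n)) = Some (Complex ((a + b) / sqrt 2) ((b - a) / sqrt 2) * ?u')"
    using w1 unfolding vdc2_unit_8 by (simp add: mult.assoc add.commute)
  from greedy_vdc2_four_steps[OF this, of w'] w'
  have "w' = Complex (pull ((a + b) / sqrt 2)) (pull ((b - a) / sqrt 2)) * ?u'"
    by (simp add: algebra_simps)
  then have "(norm w')\<^sup>2 = (pull ((a + b) / sqrt 2))\<^sup>2 + (pull ((b - a) / sqrt 2))\<^sup>2"
    by (simp add: norm_mult cmod_power2)
  also have "\<dots> \<le> (norm w)\<^sup>2 - norm w / 4"
  proof -
    have nw: "(Re p)\<^sup>2 + (Im p)\<^sup>2 = (norm w)\<^sup>2" by (simp add: p(2)[symmetric] cmod_power2)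
    have "2 \<le> (norm w)\<^sup>2" using power_mono[OF assms(3), of 2] by simp
    then show ?thesis
      using two_frames_decrease[of "Re p" "Im p"] unfolding nw a_def b_def by simp
  qed
  also have "\<dots> \<le> (norm w - 1 / 8)\<^sup>2" by (simp add: power2_eq_square algebra_simps)
  finally show ?thesis
    by (rule power2_le_imp_le) (use assms(3) sqrt2_less_2 real_sqrt_ge_one[of 2] in linarith)
qed

lemma greedy_vdc2_norm_decrease:
  assumes "greedy vdc2_unit z (8 * n) = Some w"
    and "\<And>m x. m < 8 * n \<Longrightarrow> greedy vdc2_unit z m = Some x \<Longrightarrow> sqrt 2 \<le> norm x"
  shows "norm w \<le> norm z - n / 8"
  using assms
proof (induction n arbitrary: w)
  case 0
  then show ?case by simp
next
  case (Suc n)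
  have w: "greedy vdc2_unit z (8 * n + 8) = Some w" using Suc.prems(1) by (simp add: add.commute)
  then obtain x where x: "greedy vdc2_unit z (8 * n) = Some x"
    using greedy_Some_le by (metis le_add1)
  have "norm x \<le> norm z - n / 8" by (rule Suc.IH[OF x]) (rule Suc.prems(2), auto)
  moreover have "norm w \<le> norm x - 1 / 8"
    using greedy_vdc2_eight_steps[OF x w] Suc.prems(2)[OF _ x] by simp
  ultimately show ?case by (simp add: add_divide_distrib)
qed

theorem theorem2:
  "\<exists>C::real. C > 0 \<and>
     (\<forall>z::complex. \<exists>N::nat. real N \<le> C * norm z \<and>
        (greedy vdc2_unit z N = None \<or>
         (\<exists>m\<le>N. \<exists>w \<in> ball 0 (sqrt 2). greedy vdc2_unit z m = Some w)))"
proof (rule exI[of _ 72], intro conjI allI)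
  fix z :: complex
  show "\<exists>N::nat. real N \<le> 72 * norm z \<and>
        (greedy vdc2_unit z N = None \<or>
         (\<exists>m\<le>N. \<exists>w \<in> ball 0 (sqrt 2). greedy vdc2_unit z m = Some w))"
  proof (cases "norm z < sqrt 2")
    case True
    then show ?thesis by (intro exI[of _ 0]) auto
  next
    case False
    \<comment> \<open>With this many blocks of eight steps, each costing 1/8, the norm would drop to
      at most 0 if the disk were never reached.\<close>
    define n where "n = nat \<lceil>8 * norm z\<rceil>"
    have n: "8 * norm z \<le> n" "n \<le> 8 * norm z + 1"
      unfolding n_def using norm_ge_zero[of z] by linarith+
    have "1 \<le> norm z" using False real_sqrt_ge_one[of 2] by linarith
    \<comment> \<open>Rounding up adds at most 8 to 64 |z|, which 8 |z| absorbs because |z| \<ge>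
      1.\<close>
    then have "real (8 * n) \<le> 72 * norm z" using n by simp
    moreover have "\<exists>m\<le>8 * n. \<exists>w \<in> ball 0 (sqrt 2). greedy vdc2_unit z m = Some w"
      if w: "greedy vdc2_unit z (8 * n) = Some w" for w
    proof (rule ccontr)
      assume "\<not> ?thesis"
      then have ge: "\<And>m x. m \<le> 8 * n \<Longrightarrow> greedy vdc2_unit z m = Some x \<Longrightarrow> sqrt 2 \<le> norm x"
        by (force simp: not_less)
      have "norm w \<le> norm z - n / 8" by (rule greedy_vdc2_norm_decrease[OF w]) (rule ge, auto)
      moreover have "sqrt 2 \<le> norm w" using ge w by blast
      ultimately show False using n real_sqrt_ge_one[of 2] by linarith
    qed
    ultimately show ?thesis
      by (intro exI[of _ "8 * n"]) (cases "greedy vdc2_unit z (8 * n)", auto)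
  qed
qed simp

end
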